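(* Let $(\mu_t,\delta_t,R_t)$, with $\mu_t=\sum_{i\ge0}\mu_it^i$, $\delta_t=\sum_{i\ge0}\delta_it^i$, $R_t=\sum_{i\ge0}R_it^i$, be a formal deformation of a $\lambda$-weighted Rota-Baxter AssDer pair $(\mathfrak A,\delta,R)$. Then the linear term $(\mu_1,\delta_1,R_1)$ is a $2$-cocycle in the cohomology of the weighted Rota-Baxter AssDer pair $(\mathfrak A,\delta,R)$ with coefficients in itself, i.e. $\mathfrak D_{\mathrm{R.B.AssDer}}((\mu_1,\delta_1),R_1)=0$.
   Context: Fix a field $\mathbb{K}$ and $\lambda\in\mathbb{K}$. A $\lambda$-weighted Rota-Baxter AssDer pair $(\mathfrak A,\delta,R)$ is an associative algebra $\mathfrak A=(A,\mu)$ over $\mathbb K$ with a derivation $\delta$ and a linear map $R:A\to A$ with $\mu(Rx,Ry)=R(\mu(Rx,y)+\mu(x,Ry)+\lambda\mu(x,y))$ and $R\circ\delta=\delta\circ R$. Formal deformation. A formal ($1$-parameter) deformation of $(\mathfrak A,\delta,R)$ consists of formal power series $\mu_t=\sum_{i\ge0}\mu_it^i$, $\mu_i\in\mathrm{Hom}(A^{\otimes2},A)$, $\mu_0=\mu$; $\delta_t=\sum_{i\ge0}\delta_it^i$, $\delta_i\in\mathrm{Hom}(A,A)$, $\delta_0=\delta$; $R_t=\sum_{i\ge0}R_it^i$, $R_i\in\mathrm{Hom}(A,A)$, $R_0=R$, such that (extending $\mathbb K[[t]]$-linearly to $A[[t]]$) for all $x,y,z\in A$: $\mu_t(\mu_t(x,y),z)=\mu_t(x,\mu_t(y,z))$,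 $\mu_t(R_tx,R_ty)=R_t(\mu_t(R_tx,y)+\mu_t(x,R_ty)+\lambda\mu_t(x,y))$, $\delta_t(\mu_t(x,y))=\mu_t(\delta_tx,y)+\mu_t(x,\delta_ty)$. Cohomology with coefficients in itself. Put $\mu_R(x,y)=\mu(x,Ry)+\mu(Rx,y)+\lambda\mu(x,y)$, $l_R(x,m)=\mu(Rx,m)-R(\mu(x,m))$, $r_R(m,x)=\mu(m,Rx)-R(\mu(m,x))$. On $C^n=\mathrm{Hom}(A^{\otimes n},A)$ let $(d_{\mathrm{Hoch}}f)(x_1,\dots,x_{n+1})=\mu(x_1,f(x_2,\dots,x_{n+1}))+\sum_{i=1}^n(-1)^if(x_1,\dots,\mu(x_i,x_{i+1}),\dots,x_{n+1})+(-1)^{n+1}\mu(f(x_1,\dots,x_n),x_{n+1})$; let $d_{\mathrm{R.Hoch}}f$ be $l_R(x_1,f(x_2,\dots,x_{n+1}))+\sum_{i=1}^n(-1)^if(x_1,\dots,\mu_R(x_i,x_{i+1}),\dots,x_{n+1})+(-1)^{n+1}r_R(f(x_1,\dots,x_n),x_{n+1})$; let $\partial f=\sum_{i=1}^nf\circ(\mathbf 1\otimes\cdots\otimes\delta\otimes\cdots\otimes\mathbf 1)-\delta\circ f$ ($\delta$ in the $i$-th place); and $\Phi^n(f)(x_1,\dots,x_n)=f(Rx_1,\dots,Rx_n)-\sum_{k=0}^{n-1}\lambda^{n-k-1}\sum_{i_1<\cdots<i_k}R\big(f(x_1,\dots,R(x_{i_1}),\dots,R(x_{i_k}),\dots,x_n)\big)$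 ($R$ applied exactly to the arguments in positions $i_1,\dots,i_k$). For $n\ge2$ the $n$-cochains are $\mathfrak C^n_{\mathrm{R.B.AssDer}}(A,A)=(C^n\oplus C^{n-1})\oplus C^{n-1}$, with $\mathfrak D_{\mathrm{R.B.AssDer}}((f,g),h)=(d_{\mathrm{Hoch}}f,\ d_{\mathrm{Hoch}}g+(-1)^n\partial f,\ -d_{\mathrm{R.Hoch}}h-\Phi^nf)$. *)

theory Defs
  imports
    "HOL-Computational_Algebra.Formal_Power_Series"
    "HOL-Library.Function_Algebras"
    "HOL-Library.Product_Plus"
begin

definition bilinear_over :: "('k::field \<Rightarrow> 'a::ab_group_add \<Rightarrow> 'a) \<Rightarrow> ('a \<Rightarrow> 'a \<Rightarrow> 'a) \<Rightarrow> bool" where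
  "bilinear_over scale m \<longleftrightarrow>
     (\<forall>x. Vector_Spaces.linear scale scale (m x)) \<and>
     (\<forall>y. Vector_Spaces.linear scale scale (\<lambda>x. m x y))"

locale rota_baxter_assder_pair = vector_space scale
  for scale :: "'k::field \<Rightarrow> 'a::ab_group_add \<Rightarrow> 'a" +
  fixes lam :: 'k
    and mu :: "'a \<Rightarrow> 'a \<Rightarrow> 'a"
    and delta :: "'a \<Rightarrow> 'a"
    and R :: "'a \<Rightarrow> 'a"
  assumes mu_bilinear: "bilinear_over scale mu"
    and mu_assoc: "mu (mu x y) z = mu x (mu y z)"
    and delta_linear: "Vector_Spaces.linear scale scale delta"
    and delta_derivation: "delta (mu x y) = mu (delta x) y + mu x (delta y)"
    and R_linear: "Vector_Spaces.linear scale scale R"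
    and rota_baxter: "mu (R x) (R y) = R (mu (R x) y + mu x (R y) + scale lam (mu x y))"
    and R_delta_commute: "R \<circ> delta = delta \<circ> R"


section \<open>Formal deformations\<close>

text \<open>
  Elements of \<open>A[[t]]\<close> are values of type \<^typ>\<open>'a fps\<close>. A formal power series whose coefficients are
  (bi)linear maps is the sequence of its coefficients; \<open>series_app\<close> and \<open>series_app2\<close> are its
  \<open>K[[t]]\<close>-linear extensions to \<open>A[[t]]\<close>.
\<close>

definition series_app :: "(nat \<Rightarrow> 'a \<Rightarrow> 'a) \<Rightarrow> 'a::ab_group_add fps \<Rightarrow> 'a fps" where
  "series_app F X = Abs_fps (\<lambda>n. \<Sum>i\<le>n. F i (fps_nth X (n - i)))"

definition series_app2 ::
    "(nat \<Rightarrow> 'a \<Rightarrow> 'a \<Rightarrow> 'a) \<Rightarrow> 'a::ab_group_add fps \<Rightarrow> 'a fps \<Rightarrow> 'a fps" where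
  "series_app2 M X Y =
     Abs_fps (\<lambda>n. \<Sum>i\<le>n. \<Sum>j\<le>n - i. M i (fps_nth X j) (fps_nth Y (n - i - j)))"

definition series_scale :: "('k \<Rightarrow> 'a \<Rightarrow> 'a) \<Rightarrow> 'k \<Rightarrow> 'a fps \<Rightarrow> 'a fps" where
  "series_scale scale c X = Abs_fps (\<lambda>n. scale c (fps_nth X n))"

text \<open>\<open>R\<^sub>t\<close> and \<open>\<delta>\<^sub>t\<close> are not required to commute.\<close>

definition formal_deformation ::
    "('k::field \<Rightarrow> 'a::ab_group_add \<Rightarrow> 'a) \<Rightarrow> 'k \<Rightarrow> ('a \<Rightarrow> 'a \<Rightarrow> 'a) \<Rightarrow> ('a \<Rightarrow> 'a) \<Rightarrow> ('a \<Rightarrow> 'a) \<Rightarrow>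
     (nat \<Rightarrow> 'a \<Rightarrow> 'a \<Rightarrow> 'a) \<Rightarrow> (nat \<Rightarrow> 'a \<Rightarrow> 'a) \<Rightarrow> (nat \<Rightarrow> 'a \<Rightarrow> 'a) \<Rightarrow> bool" where
  "formal_deformation scale lam mu delta R mus deltas Rs \<longleftrightarrow>
     (\<forall>i. bilinear_over scale (mus i)) \<and> mus 0 = mu \<and>
     (\<forall>i. Vector_Spaces.linear scale scale (deltas i)) \<and> deltas 0 = delta \<and>
     (\<forall>i. Vector_Spaces.linear scale scale (Rs i)) \<and> Rs 0 = R \<and>
     (let mu\<^sub>t = series_app2 mus; delta\<^sub>t = series_app deltas; R\<^sub>t = series_app Rs in
       (\<forall>a b c. let x = fps_const a; y = fps_const b; z = fps_const c in
         mu\<^sub>t (mu\<^sub>t x y) z = mu\<^sub>t x (mu\<^sub>t y z)) \<and>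
       (\<forall>a b. let x = fps_const a; y = fps_const b in
         mu\<^sub>t (R\<^sub>t x) (R\<^sub>t y) =
           R\<^sub>t (mu\<^sub>t (R\<^sub>t x) y + mu\<^sub>t x (R\<^sub>t y) + series_scale scale lam (mu\<^sub>t x y))) \<and>
       (\<forall>a b. let x = fps_const a; y = fps_const b in
         delta\<^sub>t (mu\<^sub>t x y) = mu\<^sub>t (delta\<^sub>t x) y + mu\<^sub>t x (delta\<^sub>t y)))"


section \<open>Cohomology with coefficients in itself\<close>

text \<open>
  An element of \<open>C\<^sup>n = Hom(A\<^sup>\<otimes>\<^sup>n, A)\<close> is a function on argument lists that is linear in each of \<open>n\<close>
  positions. It is set to \<open>0\<close> on lists of any other length, so that equality of cochains is equality
  of functions and the zero cochain is the zero function. The sum \<open>\<oplus>\<close> is the product of types with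
  componentwise operations. The maps below are meant for arguments in \<open>C\<^sup>n\<close>, with \<open>n\<close> explicit.
\<close>

definition cochains :: "('k::field \<Rightarrow> 'a::ab_group_add \<Rightarrow> 'a) \<Rightarrow> nat \<Rightarrow> ('a list \<Rightarrow> 'a) set" where
  "cochains scale n =
     {f. (\<forall>xs i. length xs = n \<longrightarrow> i < n \<longrightarrow>
            Vector_Spaces.linear scale scale (\<lambda>x. f (xs[i := x]))) \<and>
         (\<forall>xs. length xs \<noteq> n \<longrightarrow> f xs = 0)}"

definition cochain1 :: "('a::ab_group_add \<Rightarrow> 'a) \<Rightarrow> 'a list \<Rightarrow> 'a" where
  "cochain1 f xs = (case xs of [x] \<Rightarrow> f x | _ \<Rightarrow> 0)"

definition cochain2 :: "('a::ab_group_add \<Rightarrow> 'a \<Rightarrow> 'a) \<Rightarrow> 'a list \<Rightarrow> 'a" where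
  "cochain2 f xs = (case xs of [x, y] \<Rightarrow> f x y | _ \<Rightarrow> 0)"

text \<open>
  Hochschild differential \<open>C\<^sup>n \<rightarrow> C\<^sup>n\<^sup>+\<^sup>1\<close> for a product \<open>m\<close> on \<open>A\<close> and left and right actions \<open>l\<close>,
  \<open>r\<close> of \<open>A\<close> on itself. Lists are indexed from \<open>0\<close>: the \<open>i\<close>-th inner term multiplies the
  entries \<open>xs ! (i - 1)\<close> and \<open>xs ! i\<close>.
\<close>

definition hochschild_diff ::
    "('k::field \<Rightarrow> 'a::ab_group_add \<Rightarrow> 'a) \<Rightarrow> ('a \<Rightarrow> 'a \<Rightarrow> 'a) \<Rightarrow> ('a \<Rightarrow> 'a \<Rightarrow> 'a) \<Rightarrow> ('a \<Rightarrow> 'a \<Rightarrow> 'a) \<Rightarrow>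
     nat \<Rightarrow> ('a list \<Rightarrow> 'a) \<Rightarrow> 'a list \<Rightarrow> 'a" where
  "hochschild_diff scale m l r n f xs =
     (if length xs = n + 1 then
        l (hd xs) (f (tl xs))
        + (\<Sum>i = 1..n. scale ((-1) ^ i)
             (f (take (i - 1) xs @ [m (xs ! (i - 1)) (xs ! i)] @ drop (i + 1) xs)))
        + scale ((-1) ^ (n + 1)) (r (f (butlast xs)) (last xs))
      else 0)"

definition d_Hoch ::
    "('k::field \<Rightarrow> 'a::ab_group_add \<Rightarrow> 'a) \<Rightarrow> ('a \<Rightarrow> 'a \<Rightarrow> 'a) \<Rightarrow>
     nat \<Rightarrow> ('a list \<Rightarrow> 'a) \<Rightarrow> 'a list \<Rightarrow> 'a" where
  "d_Hoch scale mu = hochschild_diff scale mu mu mu"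

definition mu_R ::
    "('k::field \<Rightarrow> 'a::ab_group_add \<Rightarrow> 'a) \<Rightarrow> 'k \<Rightarrow> ('a \<Rightarrow> 'a \<Rightarrow> 'a) \<Rightarrow> ('a \<Rightarrow> 'a) \<Rightarrow> 'a \<Rightarrow> 'a \<Rightarrow> 'a" where
  "mu_R scale lam mu R x y = mu x (R y) + mu (R x) y + scale lam (mu x y)"

definition l_R :: "('a::ab_group_add \<Rightarrow> 'a \<Rightarrow> 'a) \<Rightarrow> ('a \<Rightarrow> 'a) \<Rightarrow> 'a \<Rightarrow> 'a \<Rightarrow> 'a" where
  "l_R mu R x m = mu (R x) m - R (mu x m)"

definition r_R :: "('a::ab_group_add \<Rightarrow> 'a \<Rightarrow> 'a) \<Rightarrow> ('a \<Rightarrow> 'a) \<Rightarrow> 'a \<Rightarrow> 'a \<Rightarrow> 'a" where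
  "r_R mu R m x = mu m (R x) - R (mu m x)"

definition d_RHoch ::
    "('k::field \<Rightarrow> 'a::ab_group_add \<Rightarrow> 'a) \<Rightarrow> 'k \<Rightarrow> ('a \<Rightarrow> 'a \<Rightarrow> 'a) \<Rightarrow> ('a \<Rightarrow> 'a) \<Rightarrow>
     nat \<Rightarrow> ('a list \<Rightarrow> 'a) \<Rightarrow> 'a list \<Rightarrow> 'a" where
  "d_RHoch scale lam mu R = hochschild_diff scale (mu_R scale lam mu R) (l_R mu R) (r_R mu R)"

definition partial_delta ::
    "('a::ab_group_add \<Rightarrow> 'a) \<Rightarrow> nat \<Rightarrow> ('a list \<Rightarrow> 'a) \<Rightarrow> 'a list \<Rightarrow> 'a" where
  "partial_delta delta n f xs =
     (if length xs = n then (\<Sum>i<n. f (xs[i := delta (xs ! i)])) - delta (f xs) else 0)"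

definition map_at :: "('a \<Rightarrow> 'a) \<Rightarrow> nat set \<Rightarrow> 'a list \<Rightarrow> 'a list" where
  "map_at R I xs = map (\<lambda>i. if i \<in> I then R (xs ! i) else xs ! i) [0..<length xs]"

definition Phi ::
    "('k::field \<Rightarrow> 'a::ab_group_add \<Rightarrow> 'a) \<Rightarrow> 'k \<Rightarrow> ('a \<Rightarrow> 'a) \<Rightarrow>
     nat \<Rightarrow> ('a list \<Rightarrow> 'a) \<Rightarrow> 'a list \<Rightarrow> 'a" where
  "Phi scale lam R n f xs =
     (if length xs = n then
        f (map R xs)
        - (\<Sum>k<n. scale (lam ^ (n - k - 1))
             (\<Sum>I | I \<subseteq> {..<n} \<and> card I = k. R (f (map_at R I xs))))
      else 0)"

type_synonym 'a rbad_cochain = "(('a list \<Rightarrow> 'a) \<times> ('a list \<Rightarrow> 'a)) \<times> ('a list \<Rightarrow> 'a)"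

text \<open>The three definitions below are meant for \<open>n \<ge> 2\<close> only.\<close>

definition rbad_cochains ::
    "('k::field \<Rightarrow> 'a::ab_group_add \<Rightarrow> 'a) \<Rightarrow> nat \<Rightarrow> 'a rbad_cochain set" where
  "rbad_cochains scale n =
     (cochains scale n \<times> cochains scale (n - 1)) \<times> cochains scale (n - 1)"

definition rbad_diff ::
    "('k::field \<Rightarrow> 'a::ab_group_add \<Rightarrow> 'a) \<Rightarrow> 'k \<Rightarrow> ('a \<Rightarrow> 'a \<Rightarrow> 'a) \<Rightarrow> ('a \<Rightarrow> 'a) \<Rightarrow> ('a \<Rightarrow> 'a) \<Rightarrow>
     nat \<Rightarrow> 'a rbad_cochain \<Rightarrow> 'a rbad_cochain" where
  "rbad_diff scale lam mu delta R n = (\<lambda>((f, g), h).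
     ((d_Hoch scale mu n f,
       d_Hoch scale mu (n - 1) g + (\<lambda>xs. scale ((-1) ^ n) (partial_delta delta n f xs))),
      - d_RHoch scale lam mu R (n - 1) h - Phi scale lam R n f))"

definition rbad_cocycles ::
    "('k::field \<Rightarrow> 'a::ab_group_add \<Rightarrow> 'a) \<Rightarrow> 'k \<Rightarrow> ('a \<Rightarrow> 'a \<Rightarrow> 'a) \<Rightarrow> ('a \<Rightarrow> 'a) \<Rightarrow> ('a \<Rightarrow> 'a) \<Rightarrow>
     nat \<Rightarrow> 'a rbad_cochain set" where
  "rbad_cocycles scale lam mu delta R n =
     {c \<in> rbad_cochains scale n. rbad_diff scale lam mu delta R n c = 0}"

end

theory Submission
  imports Defs
begin

text \<open>Each deformation equation is an identity in A[[t]], so its coefficients of t agree. On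
  constant series, every term of that coefficient contains exactly one first-order map mu_1, delta_1
  or R_1, all other maps being the undeformed ones. Hence associativity linearises to d_Hoch mu_1 =
  0, the derivation rule to d_Hoch delta_1 + partial mu_1 = 0, and the Rota-Baxter identity to
  d_RHoch R_1 + Phi^2 mu_1 = 0: the three components of the cocycle condition. The coefficients come
  from \<open>series_nth\<close>; \<open>hochschild_diff_1\<close>,
  \<open>hochschild_diff_2\<close>, \<open>partial_delta_2\<close> and \<open>Phi_2\<close> give the
  differentials in a form that matches them term by term.\<close>

lemma bilinear_over_zero:
  assumes "bilinear_over scale m"
  shows "m x 0 = 0" "m 0 y = 0"
  using assms Vector_Spaces.linear.axioms(3) module_hom.zero
  unfolding bilinear_over_def linear_iff_module_hom
  by (blast, metis (no_types, lifting))

lemma series_app_nth_0: "fps_nth (series_app F X) 0 = F 0 (fps_nth X 0)"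
  by (simp add: series_app_def)

lemma series_app_nth_1:
  "fps_nth (series_app F X) (Suc 0) = F 0 (fps_nth X (Suc 0)) + F (Suc 0) (fps_nth X 0)"
  by (simp add: series_app_def)

lemma series_app2_nth_0:
  "fps_nth (series_app2 M X Y) 0 = M 0 (fps_nth X 0) (fps_nth Y 0)"
  by (simp add: series_app2_def)

text \<open>Total degree one leaves three choices: it is spent on the second argument, the first
  argument, or the product itself.\<close>

lemma series_app2_nth_1:
  "fps_nth (series_app2 M X Y) (Suc 0) =
     M 0 (fps_nth X 0) (fps_nth Y (Suc 0)) + M 0 (fps_nth X (Suc 0)) (fps_nth Y 0)
     + M (Suc 0) (fps_nth X 0) (fps_nth Y 0)"
  by (simp add: series_app2_def)

lemma series_scale_nth: "fps_nth (series_scale scale c X) n = scale c (fps_nth X n)"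
  by (simp add: series_scale_def)

lemmas series_nth = series_app_nth_0 series_app_nth_1 series_app2_nth_0 series_app2_nth_1
  series_scale_nth

lemma cochain1_singleton [simp]: "cochain1 f [x] = f x"
  by (simp add: cochain1_def)

lemma cochain2_pair [simp]: "cochain2 f [x, y] = f x y"
  by (simp add: cochain2_def)

lemma cochain1_in_cochains:
  assumes "Vector_Spaces.linear scale scale f"
  shows "cochain1 f \<in> cochains scale 1"
proof -
  have "(\<lambda>x. cochain1 f (xs[0 := x])) = f" if "length xs = 1" for xs
    using that by (auto simp: length_Suc_conv)
  moreover have "cochain1 f xs = 0" if "length xs \<noteq> 1" for xs
    using that by (auto simp: cochain1_def split: list.splits)
  ultimately show ?thesis
    using assms by (auto simp: cochains_def)
qed

text \<open>Being a cocycle includes lying in the cochain space; the zero default of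
  \<open>cochain2\<close> agrees with the convention there for lists of other lengths.\<close>

lemma cochain2_in_cochains:
  assumes "bilinear_over scale f"
  shows "cochain2 f \<in> cochains scale 2"
proof -
  have "Vector_Spaces.linear scale scale (\<lambda>x. cochain2 f (xs[i := x]))"
    if len: "length xs = 2" and i: "i < 2" for xs i
  proof -
    obtain a b where "xs = [a, b]"
      using len by (auto simp: length_Suc_conv numeral_2_eq_2)
    then show ?thesis
      using assms i by (auto simp: bilinear_over_def numeral_2_eq_2 less_Suc_eq)
  qed
  moreover have "cochain2 f xs = 0" if "length xs \<noteq> 2" for xs
    using that by (auto simp: cochain2_def split: list.splits)
  ultimately show ?thesis
    by (auto simp: cochains_def)
qed

text \<open>The vector space axioms turn scaling by powers of -1 into plain signs; the last term
  gets (-1)^2 here and (-1)^3 in degree 2.\<close>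

lemma (in vector_space) hochschild_diff_1:
  "hochschild_diff scale m l r 1 f xs =
     (if length xs = 2 then
        l (xs ! 0) (f [xs ! 1]) - f [m (xs ! 0) (xs ! 1)] + r (f [xs ! 0]) (xs ! 1)
      else 0)"
  by (auto simp: hochschild_diff_def length_Suc_conv numeral_2_eq_2)

lemma (in vector_space) hochschild_diff_2:
  "hochschild_diff scale m l r 2 f xs =
     (if length xs = 3 then
        l (xs ! 0) (f [xs ! 1, xs ! 2]) - f [m (xs ! 0) (xs ! 1), xs ! 2]
        + f [xs ! 0, m (xs ! 1) (xs ! 2)] - r (f [xs ! 0, xs ! 1]) (xs ! 2)
      else 0)"
  by (auto simp: hochschild_diff_def length_Suc_conv numeral_2_eq_2 numeral_3_eq_3)

lemma partial_delta_2:
  "partial_delta \<delta> 2 f xs =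
     (if length xs = 2 then
        f [\<delta> (xs ! 0), xs ! 1] + f [xs ! 0, \<delta> (xs ! 1)] - \<delta> (f [xs ! 0, xs ! 1])
      else 0)"
  by (auto simp: partial_delta_def length_Suc_conv numeral_2_eq_2)

lemma singleton_subsets_lessThan_2: "{I. I \<subseteq> {..<2::nat} \<and> card I = 1} = {{0}, {1}}"
  by (auto simp: card_1_singleton_iff)

lemma (in vector_space) Phi_2:
  "Phi scale c R 2 f xs =
     (if length xs = 2 then
        f [R (xs ! 0), R (xs ! 1)] - scale c (R (f [xs ! 0, xs ! 1]))
        - R (f [R (xs ! 0), xs ! 1]) - R (f [xs ! 0, R (xs ! 1)])
      else 0)"
proof (cases "length xs = 2")
  case True
  then obtain x y where xs: "xs = [x, y]"
    by (auto simp: length_Suc_conv numeral_2_eq_2)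
  \<comment> \<open>Infinite sets also have \<open>card\<close> 0; they are excluded as subsets of a
    finite set.\<close>
  have empty: "{I. I \<subseteq> {..<2::nat} \<and> card I = 0} = {{}}"
    by (auto dest: finite_subset)
  have maps: "map_at R {} xs = [x, y]" "map_at R {0} xs = [R x, y]" "map_at R {1} xs = [x, R y]"
    by (simp_all add: map_at_def xs)
  let ?S = "\<Sum>k<2. scale (c ^ (2 - k - 1))
      (\<Sum>I | I \<subseteq> {..<2} \<and> card I = k. R (f (map_at R I xs)))"
  \<comment> \<open>For k = 0 only the empty set contributes, with weight c; for k = 1 the two
    singletons do, with weight 1.\<close>
  have "?S = scale (c ^ (2 - 0 - 1)) (\<Sum>I | I \<subseteq> {..<2} \<and> card I = 0. R (f (map_at R I xs)))
        + scale (c ^ (2 - 1 - 1)) (\<Sum>I | I \<subseteq> {..<2} \<and> card I = 1. R (f (map_at R I xs)))"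
    unfolding lessThan_nat_numeral lessThan_Suc by simp
  also have "\<dots> = scale c (R (f [x, y])) + (R (f [R x, y]) + R (f [x, R y]))"
    unfolding empty singleton_subsets_lessThan_2 by (simp add: maps del: One_nat_def)
  finally have "?S = scale c (R (f [x, y])) + (R (f [R x, y]) + R (f [x, R y]))" .
  with True xs show ?thesis
    by (simp add: Phi_def algebra_simps)
qed (simp add: Phi_def)

theorem proposition4p3:
  fixes scale :: "'k::field \<Rightarrow> 'a::ab_group_add \<Rightarrow> 'a"
    and lam :: 'k
    and mu :: "'a \<Rightarrow> 'a \<Rightarrow> 'a"
    and delta R :: "'a \<Rightarrow> 'a"
    and mus :: "nat \<Rightarrow> 'a \<Rightarrow> 'a \<Rightarrow> 'a"
    and deltas Rs :: "nat \<Rightarrow> 'a \<Rightarrow> 'a"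
  assumes "rota_baxter_assder_pair scale lam mu delta R"
    and "formal_deformation scale lam mu delta R mus deltas Rs"
  shows "((cochain2 (mus 1), cochain1 (deltas 1)), cochain1 (Rs 1))
           \<in> rbad_cocycles scale lam mu delta R 2"
proof -
  interpret rota_baxter_assder_pair scale lam mu delta R
    by fact
  have bil: "bilinear_over scale (mus i)" and lin_delta: "Vector_Spaces.linear scale scale (deltas i)"
    and lin_R: "Vector_Spaces.linear scale scale (Rs i)" for i
    using assms(2) by (auto simp: formal_deformation_def)
  have mus_0: "mus 0 = mu" and deltas_0: "deltas 0 = delta" and Rs_0: "Rs 0 = R"
    using assms(2) by (auto simp: formal_deformation_def)
  let ?m = "series_app2 mus" and ?d = "series_app deltas" and ?r = "series_app Rs"
  have assoc_t: "?m (?m (fps_const x) (fps_const y)) (fps_const z) =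
      ?m (fps_const x) (?m (fps_const y) (fps_const z))"
    and rota_baxter_t: "?m (?r (fps_const x)) (?r (fps_const y)) =
      ?r (?m (?r (fps_const x)) (fps_const y) + ?m (fps_const x) (?r (fps_const y))
          + series_scale scale lam (?m (fps_const x) (fps_const y)))"
    and derivation_t: "?d (?m (fps_const x) (fps_const y)) =
      ?m (?d (fps_const x)) (fps_const y) + ?m (fps_const x) (?d (fps_const y))" for x y z
    using assms(2) unfolding formal_deformation_def Let_def by blast+
  have mu_zero: "mu x 0 = 0" "mu 0 x = 0" for x
    using bilinear_over_zero[OF mu_bilinear] by auto
  interpret delta: Vector_Spaces.linear scale scale delta
    by (rule delta_linear)
  interpret R: Vector_Spaces.linear scale scale R
    by (rule R_linear)
  \<comment> \<open>A constant series has coefficient 0 at t, so the terms using that coefficient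
    vanish because \<open>mu\<close>, \<open>delta\<close> and \<open>R\<close> send 0 to 0.\<close>
  note coeff_simps = series_nth mus_0 deltas_0 Rs_0 mu_zero
  have assoc_1: "mu (mus 1 x y) z + mus 1 (mu x y) z = mu x (mus 1 y z) + mus 1 x (mu y z)" for x y z
    using arg_cong[OF assoc_t[of x y z], of "\<lambda>X. fps_nth X 1"] by (simp add: coeff_simps)
  have derivation_1: "delta (mus 1 x y) + deltas 1 (mu x y) =
      mu (deltas 1 x) y + mus 1 (delta x) y + (mu x (deltas 1 y) + mus 1 x (delta y))" for x y
    using arg_cong[OF derivation_t[of x y], of "\<lambda>X. fps_nth X 1"]
    by (simp add: coeff_simps)
  \<comment> \<open>On the right, R_1 meets the constant coefficient of its argument, which is
    \<open>mu_R\<close>, while R meets the coefficient of t and is distributed over it by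
    linearity.\<close>
  have rota_baxter_1: "mu (R x) (Rs 1 y) + mu (Rs 1 x) (R y) + mus 1 (R x) (R y) =
      R (mu (Rs 1 x) y) + R (mus 1 (R x) y) + R (mu x (Rs 1 y)) + R (mus 1 x (R y))
      + scale lam (R (mus 1 x y)) + Rs 1 (mu_R scale lam mu R x y)" for x y
    using arg_cong[OF rota_baxter_t[of x y], of "\<lambda>X. fps_nth X 1"]
    by (simp add: coeff_simps R.add R.scale mu_R_def ac_simps)
  have "d_Hoch scale mu 2 (cochain2 (mus 1)) = 0"
    using assoc_1 by (auto simp: fun_eq_iff d_Hoch_def hochschild_diff_2 algebra_simps)
  moreover have "d_Hoch scale mu 1 (cochain1 (deltas 1))
      + (\<lambda>xs. scale ((-1) ^ 2) (partial_delta delta 2 (cochain2 (mus 1)) xs)) = 0"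
    using derivation_1
    by (auto simp: fun_eq_iff d_Hoch_def hochschild_diff_1 partial_delta_2 algebra_simps
        simp del: One_nat_def)
  \<comment> \<open>The terms with R_1 applied to x or y pair up into \<open>r_R\<close> and
    \<open>l_R\<close>, R_1 of \<open>mu_R\<close> is the inner Hochschild term, and the terms in
    mu_1 form \<open>Phi\<close>. The simp rule \<open>One_nat_def\<close> is removed so that the
    degree stays \<open>1\<close>, as in \<open>hochschild_diff_1\<close>.\<close>
  moreover have "- d_RHoch scale lam mu R 1 (cochain1 (Rs 1)) - Phi scale lam R 2 (cochain2 (mus 1)) = 0"
    using rota_baxter_1
    by (auto simp: fun_eq_iff d_RHoch_def hochschild_diff_1 Phi_2 l_R_def r_R_def algebra_simps
        simp del: One_nat_def)
  ultimately show ?thesis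
    using cochain2_in_cochains[OF bil[of 1]] cochain1_in_cochains[OF lin_delta[of 1]]
      cochain1_in_cochains[OF lin_R[of 1]]
    by (simp add: rbad_cocycles_def rbad_cochains_def rbad_diff_def zero_prod_def)
qed

end
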